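(* Let $G$ be an infinite locally compact abelian group. Then $G$ has a quotient group which is an infinite separable metrizable group.
   Context: All topological groups are assumed to be Hausdorff. A quotient group of a topological group $G$ means $G/N$ with the quotient topology, where $N$ is a closed normal subgroup of $G$ (the case $N=\{e\}$ is allowed). *)

theory Defs
  imports "HOL-Analysis.Analysis" "HOL-Algebra.Coset"
begin

text \<open>Topological groups are Hausdorff by convention.\<close>

locale topological_group = group G for G (structure) and T +
  assumes topspace_eq: "topspace T = carrier G"
    and Hausdorff: "Hausdorff_space T"
    and continuous_mult: "continuous_map (prod_topology T T) T (\<lambda>(x, y). x \<otimes> y)"
    and continuous_inv: "continuous_map T T (\<lambda>x. inv x)"

definition quotient_topology :: "'a topology \<Rightarrow> ('a \<Rightarrow> 'b) \<Rightarrow> 'b topology" where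
  "quotient_topology X f =
     topology (\<lambda>U. U \<subseteq> f ` topspace X \<and> openin X {x \<in> topspace X. f x \<in> U})"

lemma openin_quotient_topology:
  "openin (quotient_topology X f) U \<longleftrightarrow>
     U \<subseteq> f ` topspace X \<and> openin X {x \<in> topspace X. f x \<in> U}"
proof -
  have "istopology (\<lambda>U. U \<subseteq> f ` topspace X \<and> openin X {x \<in> topspace X. f x \<in> U})"
    unfolding istopology_def
  proof (intro conjI allI impI)
    fix S T
    assume S: "S \<subseteq> f ` topspace X \<and> openin X {x \<in> topspace X. f x \<in> S}"
      and T: "T \<subseteq> f ` topspace X \<and> openin X {x \<in> topspace X. f x \<in> T}"
    show "S \<inter> T \<subseteq> f ` topspace X" using S by blast
    have "{x \<in> topspace X. f x \<in> S \<inter> T} =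
        {x \<in> topspace X. f x \<in> S} \<inter> {x \<in> topspace X. f x \<in> T}" by blast
    then show "openin X {x \<in> topspace X. f x \<in> S \<inter> T}" using S T by (simp add: openin_Int)
  next
    fix \<K>
    assume K: "\<forall>K\<in>\<K>. K \<subseteq> f ` topspace X \<and> openin X {x \<in> topspace X. f x \<in> K}"
    then show "\<Union>\<K> \<subseteq> f ` topspace X" by blast
    have "{x \<in> topspace X. f x \<in> \<Union>\<K>} = (\<Union>K\<in>\<K>. {x \<in> topspace X. f x \<in> K})" by blast
    then show "openin X {x \<in> topspace X. f x \<in> \<Union>\<K>}" using K by auto
  qed
  then show ?thesis by (simp add: quotient_topology_def)
qed

lemma topspace_quotient_topology: "topspace (quotient_topology X f) = f ` topspace X"
proof
  show "topspace (quotient_topology X f) \<subseteq> f ` topspace X"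
    using openin_topspace[of "quotient_topology X f"] unfolding openin_quotient_topology by simp
  have "{x \<in> topspace X. f x \<in> f ` topspace X} = topspace X" by blast
  then have "openin (quotient_topology X f) (f ` topspace X)"
    by (simp add: openin_quotient_topology)
  then show "f ` topspace X \<subseteq> topspace (quotient_topology X f)" by (rule openin_subset)
qed

lemma quotient_map_quotient_topology: "quotient_map X (quotient_topology X f) f"
  by (auto simp: quotient_map_def openin_quotient_topology topspace_quotient_topology)

definition quotient_group_topology ::
    "('a, 'b) monoid_scheme \<Rightarrow> 'a topology \<Rightarrow> 'a set \<Rightarrow> 'a set topology" where
  "quotient_group_topology G T N = quotient_topology T (\<lambda>x. N #>\<^bsub>G\<^esub> x)"

lemma (in topological_group) topological_group_quotient:
  assumes N: "N \<lhd> G" and cl: "closedin T N"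
  shows "topological_group (G Mod N) (quotient_group_topology G T N)"
proof -
  interpret N: normal N G by (rule N)
  have sub: "subgroup N G" by (rule N.subgroup_axioms)
  define q where "q = (\<lambda>x. N #> x)"
  define Q where "Q = quotient_group_topology G T N"
  have qm: "quotient_map T Q q"
    unfolding Q_def q_def quotient_group_topology_def by (rule quotient_map_quotient_topology)
  have cq: "continuous_map T Q q" using qm by (rule quotient_imp_continuous_map)
  have tQ: "topspace Q = q ` carrier G"
    using qm by (auto simp: quotient_map_def topspace_eq)
  have q_eq: "q x = q y \<longleftrightarrow> x \<otimes> inv y \<in> N" if "x \<in> carrier G" "y \<in> carrier G" for x y
  proof
    assume "q x = q y"
    then have "x \<in> N #> y" using that rcos_self[OF _ sub] by (auto simp: q_def)
    then show "x \<otimes> inv y \<in> N" by (simp add: N.rcos_module_imp is_group that)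
  next
    assume "x \<otimes> inv y \<in> N"
    then have "x \<in> N #> y" by (simp add: N.rcos_module_rev is_group that)
    then show "q x = q y" using repr_independence[OF _ _ sub] that by (auto simp: q_def)
  qed
  have mul: "q x <#> q y = q (x \<otimes> y)" if "x \<in> carrier G" "y \<in> carrier G" for x y
    using that by (simp add: q_def N.rcos_sum)
  have open_q: "open_map T Q q"
    unfolding open_map_def
  proof (intro allI impI)
    fix U assume U: "openin T U"
    have UG: "U \<subseteq> carrier G" using openin_subset[OF U] topspace_eq by simp
    have eq: "{x \<in> topspace T. q x \<in> q ` U} = (\<Union>n\<in>N. {x \<in> topspace T. n \<otimes> x \<in> U})"
    proof (intro subset_antisym subsetI)
      fix x assume "x \<in> {x \<in> topspace T. q x \<in> q ` U}"
      then obtain u where u: "x \<in> carrier G" "u \<in> U" "q u = q x" by (auto simp: topspace_eq)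
      then have "u \<otimes> inv x \<in> N" using q_eq UG by blast
      moreover have "(u \<otimes> inv x) \<otimes> x = u" using u UG by (auto simp: m_assoc)
      ultimately show "x \<in> (\<Union>n\<in>N. {x \<in> topspace T. n \<otimes> x \<in> U})"
        using u by (auto simp: topspace_eq intro!: bexI[of _ "u \<otimes> inv x"])
    next
      fix x assume "x \<in> (\<Union>n\<in>N. {x \<in> topspace T. n \<otimes> x \<in> U})"
      then obtain n where n: "n \<in> N" "x \<in> carrier G" "n \<otimes> x \<in> U" by (auto simp: topspace_eq)
      have nG: "n \<in> carrier G" using n(1) N.subset by blast
      have "(n \<otimes> x) \<otimes> inv x = n" using n nG by (simp add: m_assoc)
      then have "q (n \<otimes> x) = q x" using q_eq[of "n \<otimes> x" x] n nG by simp
      then show "x \<in> {x \<in> topspace T. q x \<in> q ` U}" using n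
        by (auto simp: topspace_eq intro!: image_eqI[of _ _ "n \<otimes> x"])
    qed
    have "openin T {x \<in> topspace T. n \<otimes> x \<in> U}" if "n \<in> N" for n
    proof -
      have nG: "n \<in> topspace T" using that N.subset topspace_eq by blast
      have "continuous_map T (prod_topology T T) (\<lambda>x. (n, x))"
        using nG by (intro continuous_map_pairedI) auto
      from continuous_map_compose[OF this continuous_mult]
      have "continuous_map T T (\<lambda>x. n \<otimes> x)" by (simp add: o_def)
      then show ?thesis using U by (rule openin_continuous_map_preimage)
    qed
    then have "openin T {x \<in> topspace T. q x \<in> q ` U}" unfolding eq by blast
    moreover have "q ` U \<subseteq> topspace Q" using UG tQ by blast
    ultimately show "openin Q (q ` U)" using qm unfolding quotient_map_def by blast
  qed
  define qq where "qq = (\<lambda>(x, y). (q x, q y))"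
  have "continuous_map (prod_topology T T) (prod_topology Q Q) qq"
    unfolding qq_def case_prod_unfold
    by (intro continuous_map_pairedI continuous_map_compose[OF continuous_map_fst cq, unfolded o_def]
        continuous_map_compose[OF continuous_map_snd cq, unfolded o_def])
  moreover have "open_map (prod_topology T T) (prod_topology Q Q) qq"
    unfolding open_map_def
  proof (intro allI impI)
    fix W assume W: "openin (prod_topology T T) W"
    show "openin (prod_topology Q Q) (qq ` W)"
      unfolding openin_prod_topology_alt
    proof (intro allI impI)
      fix a b assume "(a, b) \<in> qq ` W"
      then obtain x y where xy: "(x, y) \<in> W" "a = q x" "b = q y" by (auto simp: qq_def)
      obtain U V where UV: "openin T U" "openin T V" "x \<in> U" "y \<in> V" "U \<times> V \<subseteq> W"
        using W[unfolded openin_prod_topology_alt, rule_format, OF xy(1)] by blast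
      have "openin Q (q ` U)" "openin Q (q ` V)" using UV open_q by (auto simp: open_map_def)
      moreover have "q ` U \<times> q ` V \<subseteq> qq ` W"
      proof clarify
        fix u v assume "u \<in> U" "v \<in> V"
        then have "(u, v) \<in> W" using UV(5) by blast
        then show "(q u, q v) \<in> qq ` W" by (rule rev_image_eqI) (simp add: qq_def)
      qed
      moreover have "a \<in> q ` U" "b \<in> q ` V" using UV(3,4) xy by simp_all
      ultimately show "\<exists>U V. openin Q U \<and> openin Q V \<and> a \<in> U \<and> b \<in> V \<and> U \<times> V \<subseteq> qq ` W"
        by blast
    qed
  qed
  moreover have "qq ` topspace (prod_topology T T) = topspace (prod_topology Q Q)"
    by (auto simp: qq_def tQ topspace_eq image_iff)
  ultimately have qqm: "quotient_map (prod_topology T T) (prod_topology Q Q) qq"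
    by (rule continuous_open_imp_quotient_map)
  show ?thesis
    unfolding Q_def[symmetric]
  proof (intro topological_group.intro topological_group_axioms.intro)
    show "Group.group (G Mod N)" by (rule N.factorgroup_is_group)
    show "topspace Q = carrier (G Mod N)" by (simp add: tQ carrier_FactGroup q_def)
    show "continuous_map (prod_topology Q Q) Q (\<lambda>(x, y). x \<otimes>\<^bsub>G Mod N\<^esub> y)"
    proof -
      have "continuous_map (prod_topology T T) Q (q \<circ> (\<lambda>(x, y). x \<otimes> y))"
        by (rule continuous_map_compose[OF continuous_mult cq])
      then have "continuous_map (prod_topology T T) Q ((\<lambda>(x, y). x <#> y) \<circ> qq)"
        by (rule continuous_map_eq) (auto simp: qq_def mul topspace_eq)
      from continuous_compose_quotient_map[OF qqm this] show ?thesis by simp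
    qed
    show "continuous_map Q Q (\<lambda>x. inv\<^bsub>G Mod N\<^esub> x)"
    proof -
      have "continuous_map T Q (q \<circ> (\<lambda>x. inv x))"
        by (rule continuous_map_compose[OF continuous_inv cq])
      then have "continuous_map T Q ((\<lambda>x. inv\<^bsub>G Mod N\<^esub> x) \<circ> q)"
      proof (rule continuous_map_eq)
        fix x assume "x \<in> topspace T"
        then have x: "x \<in> carrier G" by (simp add: topspace_eq)
        then have "q x \<in> carrier (G Mod N)" by (simp add: carrier_FactGroup q_def)
        then show "(q \<circ> (\<lambda>x. inv x)) x = ((\<lambda>x. inv\<^bsub>G Mod N\<^esub> x) \<circ> q) x"
          using x by (simp add: N.inv_FactGroup N.rcos_inv q_def)
      qed
      from continuous_compose_quotient_map[OF qm this] show ?thesis by simp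
    qed
    show "Hausdorff_space Q"
    proof -
      let ?D = "(\<lambda>x. (x, x)) ` topspace Q"
      have "continuous_map (prod_topology T T) (prod_topology T T) (\<lambda>z. (fst z, inv (snd z)))"
        by (intro continuous_map_pairedI continuous_map_fst
            continuous_map_compose[OF continuous_map_snd continuous_inv, unfolded o_def])
      from continuous_map_compose[OF this continuous_mult]
      have "continuous_map (prod_topology T T) T (\<lambda>z. fst z \<otimes> inv (snd z))" by (simp add: o_def)
      then have "closedin (prod_topology T T)
          {z \<in> topspace (prod_topology T T). fst z \<otimes> inv (snd z) \<in> N}"
        using cl by (rule closedin_continuous_map_preimage)
      moreover have "{z \<in> topspace (prod_topology T T). fst z \<otimes> inv (snd z) \<in> N} =
          {z \<in> topspace (prod_topology T T). qq z \<in> ?D}"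
      proof (rule Collect_cong, rule conj_cong[OF refl])
        fix z assume "z \<in> topspace (prod_topology T T)"
        then have z: "fst z \<in> carrier G" "snd z \<in> carrier G" by (auto simp: topspace_eq)
        have "qq z \<in> ?D \<longleftrightarrow> q (fst z) = q (snd z)"
          using z by (auto simp: qq_def tQ case_prod_unfold)
        then show "fst z \<otimes> inv (snd z) \<in> N \<longleftrightarrow> qq z \<in> ?D" using q_eq z by blast
      qed
      moreover have "?D \<subseteq> topspace (prod_topology Q Q)" by auto
      ultimately have "closedin (prod_topology Q Q) ?D"
        using qqm[unfolded quotient_map_closedin, THEN conjunct2, rule_format, of ?D]
        by (simp only:)
      then show ?thesis by (simp add: Hausdorff_space_closedin_diagonal)
    qed
  qed
qed

end

theory Submission
  imports Defs "HOL-Algebra.Generated_Groups"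
begin

text \<open>
Let \<open>K\<close> be a compact neighbourhood of the identity; it generates an open subgroup \<open>H\<close>.

If \<open>G / H\<close> is countable, then \<open>G\<close> is \<open>\<sigma>\<close>-compact and the Kakutani--Kodaira argument applies:
for symmetric neighbourhoods \<open>V n\<close> of the identity with \<open>V (n+1) \<cdot> V (n+1) \<subseteq> V n\<close> and
\<open>V 0 \<subseteq> K\<close>, the intersection \<open>N\<close> is a closed subgroup, by compactness every open set containing
\<open>N\<close> contains some \<open>V n\<close>, and so \<open>G / N\<close> is second countable. If moreover \<open>V n\<close> avoids
\<open>f i \<otimes> inv f j\<close> for \<open>i < j \<le> n\<close>, where \<open>f\<close> is an injective sequence, then the \<open>f i\<close> lie in
distinct cosets of \<open>N\<close>.

Otherwise the abstract group \<open>A = G / H\<close> is infinite and it suffices to find a countably infinite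
quotient of \<open>A\<close>, its preimage in \<open>G\<close> being open. Take a countably infinite subgroup \<open>C\<close> of \<open>A\<close>
and a subgroup \<open>B\<close> maximal with \<open>B \<inter> C = {\<one>}\<close>. Then \<open>A / B\<close> is an essential extension of a copy
of \<open>C\<close>, and essential extensions of countable abelian groups are countable.
\<close>

section \<open>Countably infinite quotients of abelian groups\<close>

text \<open>Two maps with the same fibres on \<open>S\<close> determine each other's values. This
  moves cardinality statements between coset spaces without building a group isomorphism.\<close>

lemma bij_betw_image_images:
  assumes "\<And>x y. x \<in> S \<Longrightarrow> y \<in> S \<Longrightarrow> f x = f y \<longleftrightarrow> g x = g y"
  shows "\<exists>h. bij_betw h (f ` S) (g ` S)"
proof -
  define h where "h = (\<lambda>u. g (inv_into S f u))"
  have h: "h (f x) = g x" if "x \<in> S" for x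
  proof -
    have "inv_into S f (f x) \<in> S" "f (inv_into S f (f x)) = f x"
      using that by (simp_all add: inv_into_into f_inv_into_f)
    then show ?thesis unfolding h_def using assms[of "inv_into S f (f x)" x] that by simp
  qed
  have "inj_on h (f ` S)" using h assms unfolding inj_on_def by (metis (no_types, lifting) imageE)
  moreover have "h ` f ` S = g ` S" unfolding image_image using h by (rule image_cong[OF refl])
  ultimately show ?thesis unfolding bij_betw_def by blast
qed

section \<open>Cosets, torsion and essential extensions\<close>

lemma (in group) rcos_eq_iff:
  assumes "subgroup N G" "x \<in> carrier G" "y \<in> carrier G"
  shows "N #> x = N #> y \<longleftrightarrow> x \<otimes> inv y \<in> N"
  using assms subgroup.rcos_module[OF assms(1) is_group] repr_independence repr_independenceD
  by metis

text \<open>Commutativity makes the \<open>n\<close>-th power map a homomorphism, so each nonempty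
  fibre is a translate of its countable kernel, and only countably many fibres are united.\<close>

lemma (in comm_group) countable_pow_vimage:
  assumes "countable {x \<in> carrier G. x [^] (n::nat) = \<one>}" "countable S"
  shows "countable {x \<in> carrier G. x [^] n \<in> S}"
proof -
  have "countable {x \<in> carrier G. x [^] n = s}" for s
  proof (cases "\<exists>z\<in>carrier G. z [^] n = s")
    case True
    then obtain z where z: "z \<in> carrier G" "z [^] n = s" by blast
    have "{x \<in> carrier G. x [^] n = s} \<subseteq> (\<lambda>e. e \<otimes> z) ` {x \<in> carrier G. x [^] n = \<one>}"
    proof
      fix x assume "x \<in> {x \<in> carrier G. x [^] n = s}"
      then have x: "x \<in> carrier G" "x [^] n = s" by blast+
      have "(x \<otimes> inv z) [^] n = \<one>"
        using x z nat_pow_closed[OF z(1), of n] by (simp add: nat_pow_distrib nat_pow_inv)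
      moreover have "x = (x \<otimes> inv z) \<otimes> z" using x z by (simp add: m_assoc)
      moreover have "x \<otimes> inv z \<in> carrier G" using x z by simp
      ultimately show "x \<in> (\<lambda>e. e \<otimes> z) ` {e \<in> carrier G. e [^] n = \<one>}"
        by (metis (mono_tags, lifting) image_eqI mem_Collect_eq)
    qed
    then show ?thesis using assms(1) by (meson countable_image countable_subset)
  next
    case False
    then have "{x \<in> carrier G. x [^] n = s} = {}" by blast
    then show ?thesis by (simp only: countable_empty)
  qed
  moreover have "{x \<in> carrier G. x [^] n \<in> S} = (\<Union>s\<in>S. {x \<in> carrier G. x [^] n = s})" by blast
  ultimately show ?thesis using assms(2) by simp
qed

text \<open>For \<open>n = p * m\<close> with \<open>p\<close> prime, the \<open>n\<close>-torsion
  is the preimage of the \<open>m\<close>-torsion under the \<open>p\<close>-th power map, so the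
  prime exponents decide.\<close>

lemma (in comm_group) countable_torsion:
  assumes prime: "\<And>p::nat. prime p \<Longrightarrow> countable {x \<in> carrier G. x [^] p = \<one>}"
    and "n > 0"
  shows "countable {x \<in> carrier G. x [^] (n::nat) = \<one>}"
  using \<open>n > 0\<close>
proof (induction n rule: less_induct)
  case (less n)
  show ?case
  proof (cases "n = 1")
    case True
    then have "{x \<in> carrier G. x [^] n = \<one>} \<subseteq> {\<one>}" by auto
    then show ?thesis by (rule countable_subset) simp
  next
    case False
    then obtain p where p: "prime p" "p dvd n" using prime_factor_nat by blast
    then obtain m where m: "n = p * m" by blast
    have "m < n" "m > 0" using m less.prems prime_gt_1_nat[OF p(1)] by auto
    then have "countable {x \<in> carrier G. x [^] m = \<one>}" using less.IH by blast
    from countable_pow_vimage[OF prime[OF p(1)] this]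
    have "countable {x \<in> carrier G. x [^] p \<in> {x \<in> carrier G. x [^] m = \<one>}}" .
    moreover have "{x \<in> carrier G. x [^] p \<in> {x \<in> carrier G. x [^] m = \<one>}} =
        {x \<in> carrier G. x [^] n = \<one>}"
      using m by (auto simp: nat_pow_pow)
    ultimately show ?thesis by simp
  qed
qed

text \<open>
  Elements of prime order lie in \<open>C\<close> itself, so all torsion subgroups are countable, and every
  element has a power in \<open>C\<close>.
\<close>

lemma (in comm_group) countable_essential_extension:
  assumes C: "subgroup C G" "countable C"
    and ess: "\<And>x. x \<in> carrier G \<Longrightarrow> x \<noteq> \<one> \<Longrightarrow> \<exists>n::nat. x [^] n \<in> C - {\<one>}"
  shows "countable (carrier G)"
proof -
  have pow_C: "c [^] (k::nat) \<in> C" if "c \<in> C" for c k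
    using that C(1) by (induction k) (auto simp: subgroup.one_closed subgroup.m_closed)
  have "{x \<in> carrier G. x [^] p = \<one>} \<subseteq> C" if p: "prime p" for p :: nat
  proof clarify
    fix x assume x: "x \<in> carrier G" "x [^] p = \<one>"
    show "x \<in> C"
    proof (cases "x = \<one>")
      case True
      then show ?thesis using C(1) by (simp add: subgroup.one_closed)
    next
      case False
      then obtain n :: nat where n: "x [^] n \<in> C" "x [^] n \<noteq> \<one>" using ess x(1) by blast
      have "\<not> p dvd n"
      proof
        assume "p dvd n"
        then obtain k where "n = p * k" by blast
        then have "x [^] n = (x [^] p) [^] k" using x(1) by (simp add: nat_pow_pow)
        then show False using x(2) n(2) by simp
      qed
      then have "gcd n p = 1" using p by (metis coprime_commute coprime_iff_gcd_eq_1 prime_imp_coprime)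
      moreover have "n \<noteq> 0" using n(2) by (metis nat_pow_0)
      \<comment> \<open>Since \<open>x [^] p = \<one>\<close>, the part \<open>p * l\<close> of the
        exponent disappears, so this power of \<open>x [^] n\<close> is \<open>x\<close>
        itself.\<close>
      ultimately obtain k l where "n * k = p * l + 1" using bezout_nat[of n p] by auto
      then have "(x [^] n) [^] k = (x [^] p) [^] l \<otimes> x"
        using x(1) by (simp add: nat_pow_pow)
      then show ?thesis using pow_C[OF n(1), of k] x by simp
    qed
  qed
  then have tors: "countable {x \<in> carrier G. x [^] n = \<one>}" if "n > 0" for n :: nat
    using countable_torsion[OF _ that] C(2) countable_subset by meson
  \<comment> \<open>\<open>{\<one>}\<close> covers the one element for which \<open>ess\<close>
    gives no exponent. For the others the exponent is positive because \<open>x [^] 0\<close> is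
    \<open>\<one>\<close>, and positivity is what makes \<open>tors\<close> applicable.\<close>
  have "carrier G \<subseteq> {\<one>} \<union> (\<Union>n\<in>{0<..}. {x \<in> carrier G. x [^] (n::nat) \<in> C})"
  proof
    fix x assume x: "x \<in> carrier G"
    show "x \<in> {\<one>} \<union> (\<Union>n\<in>{0<..}. {x \<in> carrier G. x [^] (n::nat) \<in> C})"
    proof (cases "x = \<one>")
      case False
      then obtain n :: nat where n: "x [^] n \<in> C" "x [^] n \<noteq> \<one>" using ess x by blast
      then have "n > 0" by (metis gr0I nat_pow_0)
      then show ?thesis using n x by blast
    qed simp
  qed
  moreover have "countable ({\<one>} \<union> (\<Union>n\<in>{0<..}. {x \<in> carrier G. x [^] (n::nat) \<in> C}))"
    using countable_pow_vimage[OF tors C(2)] by (intro countable_Un countable_UN) auto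
  ultimately show ?thesis by (rule countable_subset)
qed

text \<open>Zorn's lemma gives \<open>B\<close> maximal among the subgroups meeting \<open>C\<close>
  only in \<open>\<one>\<close>; adjoining an \<open>x\<close> outside \<open>B\<close> must then
  produce a nontrivial element of \<open>C\<close>. Read modulo \<open>B\<close>, the last clause
  says that the image of \<open>C\<close> is essential.\<close>

lemma (in comm_group) ex_essential_complement:
  assumes C: "subgroup C G"
  shows "\<exists>B. subgroup B G \<and> B \<inter> C = {\<one>} \<and>
    (\<forall>x\<in>carrier G - B. \<exists>b\<in>B. \<exists>n::nat. b \<otimes> x [^] n \<in> C - {\<one>})"
proof -
  define F where "F = {B. subgroup B G \<and> B \<inter> C = {\<one>}}"
  have "{\<one>} \<in> F"
    using C triv_subgroup by (auto simp: F_def subgroup.one_closed)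
  moreover have "\<Union>K \<in> F" if K: "K \<noteq> {}" "subset.chain F K" for K
  proof -
    have KF: "K \<subseteq> F" and tot: "\<And>X Y. X \<in> K \<Longrightarrow> Y \<in> K \<Longrightarrow> X \<subseteq> Y \<or> Y \<subseteq> X"
      using K(2) unfolding subset_chain_def by blast+
    have sub: "subgroup X G" and int: "X \<inter> C = {\<one>}" if "X \<in> K" for X
      using KF that by (auto simp: F_def)
    have "subgroup (\<Union>K) G"
    proof (rule subgroupI)
      show "\<Union>K \<subseteq> carrier G" using subgroup.subset[OF sub] by blast
      show "\<Union>K \<noteq> {}" using K(1) subgroup.one_closed[OF sub] by blast
      show "inv a \<in> \<Union>K" if "a \<in> \<Union>K" for a
        using that subgroup.m_inv_closed[OF sub] by blast
      show "a \<otimes> b \<in> \<Union>K" if ab: "a \<in> \<Union>K" "b \<in> \<Union>K" for a b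
      proof -
        obtain X Y where XY: "X \<in> K" "a \<in> X" "Y \<in> K" "b \<in> Y" using ab by blast
        then have "\<exists>Z\<in>K. a \<in> Z \<and> b \<in> Z" using tot[of X Y] by blast
        then show ?thesis using subgroup.m_closed[OF sub] by blast
      qed
    qed
    moreover have "\<Union>K \<inter> C = {\<one>}" using K(1) int by blast
    ultimately show ?thesis by (simp add: F_def)
  qed
  ultimately obtain B where B: "B \<in> F" and max: "\<And>X. X \<in> F \<Longrightarrow> B \<subseteq> X \<Longrightarrow> X = B"
    using subset_Zorn_nonempty[of F] by blast
  have sB: "subgroup B G" and BC: "B \<inter> C = {\<one>}" using B by (auto simp: F_def)
  have Bc: "b \<in> carrier G" if "b \<in> B" for b by (rule subgroup.mem_carrier[OF sB that])
  have "\<exists>b\<in>B. \<exists>n::nat. b \<otimes> x [^] n \<in> C - {\<one>}" if x: "x \<in> carrier G" "x \<notin> B" for x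
  proof -
    \<comment> \<open>The subgroup generated by \<open>B\<close> and \<open>x\<close>: commutativity
      allows this normal form, and integer exponents give closure under inverses.\<close>
    define X where "X = {b \<otimes> x [^] k |b k. b \<in> B \<and> k \<in> (UNIV :: int set)}"
    have XI: "b \<otimes> x [^] (k::int) \<in> X" if "b \<in> B" for b k using that by (auto simp: X_def)
    have "subgroup X G"
    proof (rule subgroupI)
      show "X \<subseteq> carrier G" using Bc x by (auto simp: X_def)
      show "X \<noteq> {}" using XI subgroup.one_closed[OF sB] by blast
      show "inv a \<in> X" if "a \<in> X" for a
      proof -
        obtain b k where a: "a = b \<otimes> x [^] (k::int)" "b \<in> B" using \<open>a \<in> X\<close> by (auto simp: X_def)
        have "inv a = inv b \<otimes> x [^] (- k)"
          using a Bc x by (simp add: inv_mult int_pow_neg)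
        then show ?thesis using XI a sB by (simp add: subgroup.m_inv_closed)
      qed
      show "a \<otimes> a' \<in> X" if "a \<in> X" "a' \<in> X" for a a'
      proof -
        obtain b k where a: "a = b \<otimes> x [^] (k::int)" "b \<in> B" using \<open>a \<in> X\<close> by (auto simp: X_def)
        obtain b' k' where a': "a' = b' \<otimes> x [^] (k'::int)" "b' \<in> B"
          using \<open>a' \<in> X\<close> by (auto simp: X_def)
        have "a \<otimes> a' = (b \<otimes> b') \<otimes> x [^] (k + k')"
          using a a' Bc x by (simp add: int_pow_mult m_ac)
        then show ?thesis using XI a a' sB by (simp add: subgroup.m_closed)
      qed
    qed
    moreover have "B \<subseteq> X"
    proof
      fix b assume "b \<in> B"
      then show "b \<in> X" using XI[of b 0] Bc by simp
    qed
    moreover have "x \<in> X" using XI[OF subgroup.one_closed[OF sB], of 1] x by simp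
    ultimately have "X \<inter> C \<noteq> {\<one>}" using max[of X] x(2) by (auto simp: F_def)
    moreover have "\<one> \<in> X \<inter> C"
      using \<open>subgroup X G\<close> C by (simp add: subgroup.one_closed)
    ultimately obtain c where c: "c \<in> X" "c \<in> C" "c \<noteq> \<one>" by blast
    then obtain b k where bk: "c = b \<otimes> x [^] (k::int)" "b \<in> B" by (auto simp: X_def)
    show ?thesis
    proof (cases "k \<ge> 0")
      case True
      then have "x [^] k = x [^] nat k" by (simp add: int_pow_int[symmetric])
      then show ?thesis using bk c by auto
    next
      case False
      \<comment> \<open>A negative exponent is removed by passing to \<open>inv c\<close>, again a
        nontrivial element of \<open>C\<close>.\<close>
      then have k: "x [^] (nat (- k)) = x [^] (- k)" by (simp add: int_pow_int[symmetric])
      have "inv c = inv b \<otimes> x [^] (nat (- k))"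
        unfolding k using bk Bc x by (simp add: inv_mult int_pow_neg)
      moreover have "inv c \<in> C" using C c by (simp add: subgroup.m_inv_closed)
      moreover have "inv c \<noteq> \<one>" using c C subgroup.mem_carrier by (metis inv_eq_1_iff)
      moreover have "inv b \<in> B" using bk sB by (simp add: subgroup.m_inv_closed)
      ultimately show ?thesis by auto
    qed
  qed
  then show ?thesis using sB BC by blast
qed

text \<open>The iterated squares increase because each contains \<open>\<one>\<close>, so a product
  of two elements is caught one stage after the later of their stages. A property preserved by
  products of sets, such as countability or compactness, then holds at every stage.\<close>

lemma (in group) generate_subset_UN_squares:
  assumes S: "S \<subseteq> carrier G"
    and P0: "{\<one>} \<union> S \<union> (\<lambda>x. inv x) ` S \<subseteq> P 0"
    and PSuc: "\<And>n. P (Suc n) = P n <#> P n"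
    and P: "\<And>n::nat. P n \<subseteq> carrier G"
  shows "generate G S \<subseteq> (\<Union>n. P n)"
proof -
  have one: "\<one> \<in> P n" for n
  proof (induction n)
    case (Suc n)
    then have "\<one> \<otimes> \<one> \<in> P (Suc n)" unfolding PSuc set_mult_def by blast
    then show ?case by simp
  qed (use P0 in blast)
  have "P n \<subseteq> P (Suc n)" for n
  proof
    fix x assume x: "x \<in> P n"
    then have "x \<otimes> \<one> \<in> P (Suc n)" using one unfolding PSuc set_mult_def by blast
    then show "x \<in> P (Suc n)" using x P by (simp add: subset_iff)
  qed
  then have mono: "P m \<subseteq> P n" if "m \<le> n" for m n using that by (rule lift_Suc_mono_le)
  show ?thesis
  proof
    fix x assume "x \<in> generate G S"
    then show "x \<in> (\<Union>n. P n)"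
    proof (induction rule: generate.induct)
      case (eng x y)
      then obtain m n where "x \<in> P m" "y \<in> P n" by blast
      then have "x \<in> P (max m n)" "y \<in> P (max m n)"
        using mono[of m "max m n"] mono[of n "max m n"] by auto
      then have "x \<otimes> y \<in> P (Suc (max m n))" unfolding PSuc set_mult_def by blast
      then show ?case by blast
    qed (use P0 in blast)+
  qed
qed

lemma (in group) countable_generate:
  assumes S: "S \<subseteq> carrier G" "countable S"
  shows "countable (generate G S)"
proof -
  define P where "P = rec_nat ({\<one>} \<union> S \<union> (\<lambda>x. inv x) ` S) (\<lambda>_ A. A <#> A)"
  have P: "P 0 = {\<one>} \<union> S \<union> (\<lambda>x. inv x) ` S" "P (Suc n) = P n <#> P n" for n
    by (simp_all add: P_def)
  have "P n \<subseteq> carrier G \<and> countable (P n)" for n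
  proof (induction n)
    case 0
    then show ?case using S by (auto simp: P)
  next
    case (Suc n)
    then show ?case
      using setmult_subset_G by (auto simp: P set_mult_def)
  qed
  then have "countable (\<Union>n. P n)" and "\<And>n. P n \<subseteq> carrier G" by auto
  moreover have "generate G S \<subseteq> (\<Union>n. P n)"
    using generate_subset_UN_squares[of S P] S(1) P \<open>\<And>n. P n \<subseteq> carrier G\<close> by simp
  ultimately show ?thesis using countable_subset by meson
qed

section \<open>Countably infinite quotients via maximal complements\<close>

lemma (in comm_group) ex_countably_infinite_quotient:
  assumes "infinite (carrier G)"
  shows "\<exists>B. subgroup B G \<and> infinite (rcosets B) \<and> countable (rcosets B)"
proof -
  obtain S where S: "S \<subseteq> carrier G" "infinite S" "countable S"
    using infinite_countable_subset'[OF assms] by blast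
  define C where "C = generate G S"
  have C: "subgroup C G" "countable C" "S \<subseteq> C"
    using generate_is_subgroup countable_generate S by (auto simp: C_def generate.incl)
  obtain B where B: "subgroup B G" "B \<inter> C = {\<one>}"
    and ess: "\<And>x. x \<in> carrier G - B \<Longrightarrow> \<exists>b\<in>B. \<exists>n::nat. b \<otimes> x [^] n \<in> C - {\<one>}"
    using ex_essential_complement[OF C(1)] by blast
  interpret B: normal B G using B(1) by (rule subgroup_imp_normal)
  interpret Q: comm_group "G Mod B" using B(1) by (rule abelian_FactGroup)
  have hom: "group_hom G (G Mod B) (\<lambda>x. B #> x)"
    by (intro group_hom.intro group_hom_axioms.intro is_group Q.is_group B.r_coset_hom_Mod)
  have C_carrier: "c \<in> carrier G" if "c \<in> C" for c by (rule subgroup.mem_carrier[OF C(1) that])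
  \<comment> \<open>Trivial intersection with \<open>B\<close> embeds \<open>C\<close> in the
    quotient, which makes the quotient infinite.\<close>
  have inj: "inj_on (\<lambda>x. B #> x) C"
  proof (rule inj_onI)
    fix c d assume cd: "c \<in> C" "d \<in> C" "B #> c = B #> d"
    then have "c \<otimes> inv d \<in> B" using rcos_eq_iff[OF B(1)] C_carrier by blast
    moreover have "c \<otimes> inv d \<in> C" using cd C(1) by (simp add: subgroup.m_closed subgroup.m_inv_closed)
    ultimately have "c \<otimes> inv d = \<one>" using B(2) by blast
    then show "c = d" using cd C_carrier by (metis inv_closed inv_equality inv_inv)
  qed
  have carr: "carrier (G Mod B) = rcosets B" by (simp add: FactGroup_def)
  have "countable (carrier (G Mod B))"
  proof (rule Q.countable_essential_extension)
    show "subgroup ((\<lambda>x. B #> x) ` C) (G Mod B)"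
      by (rule group_hom.subgroup_img_is_subgroup[OF hom C(1)])
    show "countable ((\<lambda>x. B #> x) ` C)" using C(2) by simp
    fix X assume X: "X \<in> carrier (G Mod B)" "X \<noteq> \<one>\<^bsub>G Mod B\<^esub>"
    then obtain x where x: "x \<in> carrier G" "X = B #> x" by (auto simp: carrier_FactGroup)
    then have "x \<notin> B" using X(2) B(1) by (auto simp: subgroup.rcos_const[OF B(1) is_group])
    then obtain b n where bn: "b \<in> B" "b \<otimes> x [^] (n::nat) \<in> C - {\<one>}" using ess x(1) by blast
    have bG: "b \<in> carrier G" using bn(1) B.subset by blast
    have "b \<otimes> x [^] n \<in> B #> (x [^] n)" using bn(1) by (auto simp: r_coset_def)
    then have eq: "X [^]\<^bsub>G Mod B\<^esub> n = B #> (b \<otimes> x [^] n)"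
      using repr_independence[OF _ _ B(1)] x by (simp add: B.FactGroup_pow)
    moreover have "B #> (b \<otimes> x [^] n) \<noteq> B"
    proof
      assume "B #> (b \<otimes> x [^] n) = B"
      then have "b \<otimes> x [^] n \<in> B" using rcos_self[OF _ B(1), of "b \<otimes> x [^] n"] bG x by simp
      then show False using bn B(2) by blast
    qed
    ultimately show "\<exists>n::nat. X [^]\<^bsub>G Mod B\<^esub> n \<in> (\<lambda>x. B #> x) ` C - {\<one>\<^bsub>G Mod B\<^esub>}"
      using bn(2) by (intro exI[of _ n]) auto
  qed
  moreover have "infinite ((\<lambda>x. B #> x) ` C)"
    using inj S(2) C(3) finite_imageD finite_subset by blast
  then have "infinite (carrier (G Mod B))"
    using C_carrier by (metis carrier_FactGroup finite_subset image_mono subsetI)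
  ultimately show ?thesis using B(1) carr by auto
qed

text \<open>The quotient found for \<open>G Mod H\<close> is pulled back to \<open>G\<close>, as in
  the third isomorphism theorem. The inclusion of \<open>H\<close> later makes \<open>N\<close>
  open.\<close>

lemma (in comm_group) ex_countably_infinite_quotient_above:
  assumes H: "subgroup H G" and inf: "infinite (rcosets H)"
  shows "\<exists>N. subgroup N G \<and> H \<subseteq> N \<and> infinite (rcosets N) \<and> countable (rcosets N)"
proof -
  interpret H: normal H G using H by (rule subgroup_imp_normal)
  interpret Q: comm_group "G Mod H" using H by (rule abelian_FactGroup)
  have "infinite (carrier (G Mod H))" using inf by (simp add: FactGroup_def)
  then obtain B where B: "subgroup B (G Mod H)"
    "infinite (rcosets\<^bsub>G Mod H\<^esub> B)" "countable (rcosets\<^bsub>G Mod H\<^esub> B)"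
    using Q.ex_countably_infinite_quotient by blast
  \<comment> \<open>The members of \<open>B\<close> are cosets of \<open>H\<close>, so their union
    is the preimage of \<open>B\<close> under the projection.\<close>
  define N where "N = \<Union>B"
  have N: "subgroup N G" unfolding N_def by (rule H.factgroup_subgroup_union_subgroup[OF B(1)])
  have N_eq: "N = {x \<in> carrier G. H #> x \<in> B}"
    unfolding N_def by (rule H.factgroup_subgroup_union_char[OF B(1)])
  have "H \<subseteq> N" using subgroup.one_closed[OF B(1)] by (auto simp: N_def)
  \<comment> \<open>Both coset maps on \<open>carrier G\<close> have the same fibres; the resulting
    bijection of coset spaces suffices, as only cardinalities are compared.\<close>
  have "N #> x = N #> y \<longleftrightarrow> B #>\<^bsub>G Mod H\<^esub> (H #> x) = B #>\<^bsub>G Mod H\<^esub> (H #> y)"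
    if xy: "x \<in> carrier G" "y \<in> carrier G" for x y
  proof -
    have c: "H #> x \<in> carrier (G Mod H)" "H #> y \<in> carrier (G Mod H)"
      using xy by (auto simp: carrier_FactGroup)
    have "(H #> x) \<otimes>\<^bsub>G Mod H\<^esub> inv\<^bsub>G Mod H\<^esub> (H #> y) = H #> (x \<otimes> inv y)"
      using xy c by (simp add: H.inv_FactGroup H.rcos_inv H.rcos_sum)
    then show ?thesis
      using rcos_eq_iff[OF N xy] Q.rcos_eq_iff[OF B(1) c] xy by (auto simp: N_eq)
  qed
  then obtain h where h: "bij_betw h ((\<lambda>x. N #> x) ` carrier G)
      ((\<lambda>x. B #>\<^bsub>G Mod H\<^esub> (H #> x)) ` carrier G)"
    using bij_betw_image_images[of "carrier G" "\<lambda>x. N #> x" "\<lambda>x. B #>\<^bsub>G Mod H\<^esub> (H #> x)"]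
    by blast
  have "(\<lambda>x. N #> x) ` carrier G = rcosets N" by (auto simp: RCOSETS_def)
  moreover have "(\<lambda>x. B #>\<^bsub>G Mod H\<^esub> (H #> x)) ` carrier G = rcosets\<^bsub>G Mod H\<^esub> B"
    by (auto simp: RCOSETS_def carrier_FactGroup)
  ultimately have "bij_betw h (rcosets N) (rcosets\<^bsub>G Mod H\<^esub> B)" using h by simp
  then have "infinite (rcosets N) \<and> countable (rcosets N)"
    using B(2,3) bij_betw_finite countable_image_inj_on unfolding bij_betw_def
    by (metis finite_imageI)
  then show ?thesis using N \<open>H \<subseteq> N\<close> by blast
qed

section \<open>Urysohn's metrization theorem\<close>

text \<open>Regular and Lindelof spaces are normal, so Urysohn functions exist; countably many of
  them separate points from closed sets and embed \<open>X\<close> in a countable power of the real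
  line.\<close>

theorem regular_second_countable_imp_metrizable_space:
  assumes reg: "regular_space X" and Haus: "Hausdorff_space X" and sc: "second_countable X"
  shows "metrizable_space X"
proof -
  obtain \<B> where \<B>: "countable \<B>" "\<And>V. V \<in> \<B> \<Longrightarrow> openin X V"
    and base: "\<And>U x. openin X U \<Longrightarrow> x \<in> U \<Longrightarrow> \<exists>V\<in>\<B>. x \<in> V \<and> V \<subseteq> U"
    using sc unfolding second_countable_def by metis
  have norm: "normal_space X"
    using reg sc by (intro regular_Lindelof_imp_normal_space second_countable_imp_Lindelof_space)
  \<comment> \<open>Each pair of basic sets with the closure of the first inside the second
    contributes one coordinate; the index set is countable because the base is.\<close>
  define I where "I = {i \<in> \<B> \<times> \<B>. X closure_of fst i \<subseteq> snd i}"
  have "\<exists>f. continuous_map X euclideanreal f \<and>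
      f ` (X closure_of fst i) \<subseteq> {0} \<and> f ` (topspace X - snd i) \<subseteq> {1}" if "i \<in> I" for i
  proof -
    have "closedin X (topspace X - snd i)" "disjnt (X closure_of fst i) (topspace X - snd i)"
      using that \<B>(2) by (auto simp: I_def disjnt_iff)
    then show ?thesis using norm unfolding normal_space_iff_Urysohn_alt by simp
  qed
  then obtain f where contf: "\<And>i. i \<in> I \<Longrightarrow> continuous_map X euclideanreal (f i)"
    and f0: "\<And>i. i \<in> I \<Longrightarrow> f i ` (X closure_of fst i) \<subseteq> {0}"
    and f1: "\<And>i. i \<in> I \<Longrightarrow> f i ` (topspace X - snd i) \<subseteq> {1::real}"
    by metis
  have sep: "\<exists>i\<in>I. f i x = 0 \<and> (\<forall>y\<in>topspace X - W. f i y = 1)"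
    if W: "openin X W" "x \<in> W" for x W
  proof -
    obtain V where V: "V \<in> \<B>" "x \<in> V" "V \<subseteq> W" using base[OF W] by blast
    \<comment> \<open>Regularity puts a closed neighbourhood \<open>C\<close> of \<open>x\<close>
      inside the basic set \<open>V\<close>; a basic \<open>U'\<close> inside it then has its
      closure in \<open>V\<close>, so \<open>(U', V)\<close> is an index.\<close>
    then obtain U C where UC: "openin X U" "closedin X C" "x \<in> U" "U \<subseteq> C" "C \<subseteq> V"
      using reg \<B>(2) unfolding neighbourhood_base_of_closedin[symmetric] neighbourhood_base_of
      by meson
    obtain U' where U': "U' \<in> \<B>" "x \<in> U'" "U' \<subseteq> U" using base[OF UC(1,3)] by blast
    have "X closure_of U' \<subseteq> C" using U' UC by (intro closure_of_minimal) auto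
    then have i: "(U', V) \<in> I" using U' V UC by (auto simp: I_def)
    have "x \<in> X closure_of U'" using closure_of_subset[OF openin_subset[OF \<B>(2)[OF U'(1)]]] U'(2) by blast
    then have "f (U', V) x = 0" using f0[OF i] by auto
    moreover have "\<forall>y\<in>topspace X - W. f (U', V) y = 1" using f1[OF i] V(3) by fastforce
    ultimately show ?thesis using i by blast
  qed
  define P where "P = product_topology (\<lambda>_. euclideanreal) I"
  define e where "e = (\<lambda>x. \<lambda>i\<in>I. f i x)"
  have conte: "continuous_map X P e"
    using contf by (auto simp: P_def e_def continuous_map_componentwise)
  have tope: "e ` topspace X \<subseteq> topspace P"
    using conte by (simp add: continuous_map_image_subset_topspace)
  have "inj_on e (topspace X)"
  proof (rule inj_onI, rule ccontr)
    fix x y assume xy: "x \<in> topspace X" "y \<in> topspace X" "e x = e y" "x \<noteq> y"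
    have "openin X (topspace X - {y})"
      using Haus xy by (simp add: closedin_Hausdorff_singleton openin_diff)
    then obtain i where "i \<in> I" "f i x = 0" "f i y = 1" using sep[of "topspace X - {y}" x] xy by auto
    then show False using fun_cong[OF xy(3), of i] by (simp add: e_def)
  qed
  moreover have "open_map X (subtopology P (e ` topspace X)) e"
    unfolding open_map_def
  proof (intro allI impI)
    fix W assume W: "openin X W"
    show "openin (subtopology P (e ` topspace X)) (e ` W)"
    proof (subst openin_subopen, intro ballI)
      fix z assume "z \<in> e ` W"
      then obtain x where x: "x \<in> W" "z = e x" by blast
      obtain i where i: "i \<in> I" "f i x = 0" "\<And>y. y \<in> topspace X - W \<Longrightarrow> f i y = 1"
        using sep[OF W x(1)] by blast
      have xX: "x \<in> topspace X" using openin_subset[OF W] x(1) by blast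
      define O' where "O' = {u \<in> topspace P. u i \<in> {..<1}}"
      have "continuous_map P euclideanreal (\<lambda>u. u i)"
        unfolding P_def using i(1) by (rule continuous_map_product_projection)
      then have "openin P O'" unfolding O'_def
        by (rule openin_continuous_map_preimage) (simp add: open_lessThan)
      then have "openin (subtopology P (e ` topspace X)) (O' \<inter> e ` topspace X)"
        by (rule openin_subtopology_Int)
      moreover have "z \<in> O' \<inter> e ` topspace X"
        using x xX i tope by (auto simp: O'_def e_def)
      moreover have "O' \<inter> e ` topspace X \<subseteq> e ` W"
      proof clarify
        fix y assume y: "y \<in> topspace X" "e y \<in> O'"
        then have "f i y \<noteq> 1" using i(1) by (auto simp: O'_def e_def)
        then show "e y \<in> e ` W" using i(3) y(1) by blast
      qed
      ultimately show "\<exists>S. openin (subtopology P (e ` topspace X)) S \<and> z \<in> S \<and> S \<subseteq> e ` W"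
        by blast
    qed
  qed
  moreover have "topspace (subtopology P (e ` topspace X)) = e ` topspace X"
    using tope by (simp add: inf_absorb2)
  ultimately have "homeomorphic_map X (subtopology P (e ` topspace X)) e"
    using conte by (intro bijective_open_imp_homeomorphic_map) (simp_all add: continuous_map_in_subtopology)
  then have "X homeomorphic_space subtopology P (e ` topspace X)"
    by (rule homeomorphic_map_imp_homeomorphic_space)
  moreover have "countable I"
    using \<B>(1) by (auto simp: I_def)
  then have "metrizable_space P"
    by (auto simp: P_def metrizable_space_product_topology metrizable_space_euclidean)
  then have "metrizable_space (subtopology P (e ` topspace X))"
    by (rule metrizable_space_subtopology)
  ultimately show ?thesis by (simp add: homeomorphic_metrizable_space)
qed

section \<open>Neighbourhood chains and \<open>\<sigma>\<close>-compact groups\<close>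

context topological_group
begin

section \<open>Translations and openness of the projection\<close>

lemma continuous_mult_left:
  assumes "a \<in> carrier G"
  shows "continuous_map T T (\<lambda>x. a \<otimes> x)"
proof -
  have "continuous_map T (prod_topology T T) (\<lambda>x. (a, x))"
    using assms topspace_eq by (intro continuous_map_pairedI) auto
  from continuous_map_compose[OF this continuous_mult] show ?thesis by (simp add: o_def)
qed

lemma continuous_mult_right:
  assumes "a \<in> carrier G"
  shows "continuous_map T T (\<lambda>x. x \<otimes> a)"
proof -
  have "continuous_map T (prod_topology T T) (\<lambda>x. (x, a))"
    using assms topspace_eq by (intro continuous_map_pairedI) auto
  from continuous_map_compose[OF this continuous_mult] show ?thesis by (simp add: o_def)
qed

lemma openin_carrier: "openin T U \<Longrightarrow> x \<in> U \<Longrightarrow> x \<in> carrier G"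
  using openin_subset[of T U] topspace_eq by auto

lemma openin_translate:
  assumes U: "openin T U" and a: "a \<in> carrier G"
  shows "openin T (U #> a)"
proof -
  have "U #> a = {x \<in> topspace T. x \<otimes> inv a \<in> U}"
  proof (intro subset_antisym subsetI)
    fix x assume "x \<in> U #> a"
    then obtain u where u: "u \<in> U" "x = u \<otimes> a" by (auto simp: r_coset_def)
    then show "x \<in> {x \<in> topspace T. x \<otimes> inv a \<in> U}"
      using openin_carrier[OF U u(1)] a by (simp add: topspace_eq m_assoc)
  next
    fix x assume "x \<in> {x \<in> topspace T. x \<otimes> inv a \<in> U}"
    then have x: "x \<in> carrier G" "x \<otimes> inv a \<in> U" by (simp_all add: topspace_eq)
    then have "(x \<otimes> inv a) \<otimes> a \<in> U #> a" by (auto simp: r_coset_def)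
    then show "x \<in> U #> a" using x(1) a by (simp add: m_assoc)
  qed
  then show ?thesis
    using openin_continuous_map_preimage[OF continuous_mult_right[of "inv a"] U] a by simp
qed

text \<open>The saturation of \<open>U\<close> is a union of translates of \<open>U\<close> by
  elements of \<open>N\<close>, hence open.\<close>

lemma openin_quotient_image:
  assumes N: "subgroup N G" and U: "openin T U"
  shows "openin (quotient_group_topology G T N) ((\<lambda>x. N #> x) ` U)"
proof -
  have "{x \<in> topspace T. N #> x \<in> (\<lambda>x. N #> x) ` U} = (\<Union>n\<in>N. {x \<in> topspace T. n \<otimes> x \<in> U})"
  proof (intro subset_antisym subsetI)
    fix x assume "x \<in> {x \<in> topspace T. N #> x \<in> (\<lambda>x. N #> x) ` U}"
    then obtain u where u: "x \<in> carrier G" "u \<in> U" "N #> x = N #> u" by (auto simp: topspace_eq)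
    note uG = openin_carrier[OF U u(2)]
    have "u \<otimes> inv x \<in> N" using rcos_eq_iff[OF N uG u(1)] u(3) by simp
    moreover have "(u \<otimes> inv x) \<otimes> x = u" using u(1) uG by (simp add: m_assoc)
    ultimately show "x \<in> (\<Union>n\<in>N. {x \<in> topspace T. n \<otimes> x \<in> U})"
      using u by (auto simp: topspace_eq intro!: bexI[of _ "u \<otimes> inv x"])
  next
    fix x assume "x \<in> (\<Union>n\<in>N. {x \<in> topspace T. n \<otimes> x \<in> U})"
    then obtain n where n: "n \<in> N" "x \<in> carrier G" "n \<otimes> x \<in> U" by (auto simp: topspace_eq)
    have "n \<otimes> x \<in> N #> x" using n(1) by (auto simp: r_coset_def)
    then have "N #> x = N #> (n \<otimes> x)" using repr_independence[OF _ n(2) N] by simp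
    then show "x \<in> {x \<in> topspace T. N #> x \<in> (\<lambda>x. N #> x) ` U}"
      using n by (simp add: topspace_eq)
  qed
  moreover have "openin T {x \<in> topspace T. n \<otimes> x \<in> U}" if "n \<in> N" for n
    using openin_continuous_map_preimage[OF continuous_mult_left U] subgroup.mem_carrier[OF N that]
    by simp
  moreover have "(\<lambda>x. N #> x) ` U \<subseteq> (\<lambda>x. N #> x) ` topspace T"
    using openin_subset[OF U] by (rule image_mono)
  ultimately show ?thesis
    unfolding quotient_group_topology_def openin_quotient_topology by auto
qed

section \<open>Chains of symmetric neighbourhoods of the identity\<close>

lemma nbhd_one_square_root:
  assumes U: "openin T U" "\<one> \<in> U"
  shows "\<exists>V. openin T V \<and> \<one> \<in> V \<and> (\<forall>x\<in>V. inv x \<in> V) \<and> (\<forall>x\<in>V. \<forall>y\<in>V. x \<otimes> y \<in> U)"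
proof -
  define W where "W = {z \<in> topspace (prod_topology T T). (\<lambda>(x, y). x \<otimes> y) z \<in> U}"
  have W: "openin (prod_topology T T) W"
    unfolding W_def by (rule openin_continuous_map_preimage[OF continuous_mult U(1)])
  have "(\<one>, \<one>) \<in> W" using U(2) by (simp add: W_def topspace_eq)
  then obtain A B where AB: "openin T A" "openin T B" "\<one> \<in> A" "\<one> \<in> B" "A \<times> B \<subseteq> W"
    using W unfolding openin_prod_topology_alt by meson
  \<comment> \<open>\<open>A\<close> and \<open>B\<close> come from continuity of multiplication at
    the identity; intersecting \<open>A \<inter> B\<close> with its preimage under inversion makes
    it symmetric.\<close>
  define V where "V = (A \<inter> B) \<inter> {x \<in> topspace T. inv x \<in> A \<inter> B}"
  have AB_open: "openin T (A \<inter> B)" by (rule openin_Int[OF AB(1,2)])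
  have "openin T V"
    unfolding V_def
    by (rule openin_Int[OF AB_open openin_continuous_map_preimage[OF continuous_inv AB_open]])
  moreover have "\<one> \<in> V" using AB by (simp add: V_def topspace_eq)
  moreover have "\<forall>x\<in>V. inv x \<in> V" by (simp add: V_def topspace_eq)
  moreover have "x \<otimes> y \<in> U" if "x \<in> V" "y \<in> V" for x y
  proof -
    have "(x, y) \<in> A \<times> B" using that by (simp add: V_def)
    then have "(x, y) \<in> W" using AB(5) by (rule rev_subsetD)
    then show ?thesis by (simp add: W_def)
  qed
  ultimately show ?thesis by (intro exI[of _ V] conjI ballI) simp_all
qed

text \<open>The sequences of the Birkhoff-Kakutani and Kakutani-Kodaira arguments; passing from
  stage \<open>Suc n\<close> to stage \<open>n\<close> under products plays the part of a triangle
  inequality.\<close>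

definition nbhd_chain :: "(nat \<Rightarrow> 'a set) \<Rightarrow> bool" where
  "nbhd_chain V \<longleftrightarrow> (\<forall>n. openin T (V n) \<and> \<one> \<in> V n \<and> (\<forall>x\<in>V n. inv x \<in> V n) \<and>
     (\<forall>x\<in>V (Suc n). \<forall>y\<in>V (Suc n). x \<otimes> y \<in> V n))"

lemma nbhd_chainD:
  assumes "nbhd_chain V"
  shows "openin T (V n)" "\<one> \<in> V n" "x \<in> V n \<Longrightarrow> inv x \<in> V n"
    "x \<in> V (Suc n) \<Longrightarrow> y \<in> V (Suc n) \<Longrightarrow> x \<otimes> y \<in> V n" "x \<in> V n \<Longrightarrow> x \<in> carrier G"
  using assms openin_carrier unfolding nbhd_chain_def by metis+

text \<open>Dependent choice: each new stage is a square root of the previous stage cut down by the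
  next prescribed neighbourhood.\<close>

lemma ex_nbhd_chain:
  assumes U: "\<And>n. openin T (U n)" "\<And>n. \<one> \<in> U n"
  shows "\<exists>V. nbhd_chain V \<and> (\<forall>n. V n \<subseteq> U n)"
proof -
  define P where "P = (\<lambda>n X. openin T X \<and> \<one> \<in> X \<and> (\<forall>x\<in>X. inv x \<in> X) \<and> X \<subseteq> U n)"
  have step: "\<exists>Y. P n Y \<and> (\<forall>x\<in>Y. \<forall>y\<in>Y. x \<otimes> y \<in> X)" if X: "openin T X" "\<one> \<in> X" for X n
  proof -
    have "openin T (X \<inter> U n)" "\<one> \<in> X \<inter> U n" using X U by auto
    from nbhd_one_square_root[OF this] obtain Y where Y: "openin T Y" "\<one> \<in> Y"
      "\<forall>x\<in>Y. inv x \<in> Y" "\<forall>x\<in>Y. \<forall>y\<in>Y. x \<otimes> y \<in> X \<inter> U n" by auto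
    \<comment> \<open>Products of two elements of \<open>Y\<close> lie in \<open>U n\<close>, so
      taking \<open>\<one>\<close> as one factor puts \<open>Y\<close> itself inside
      \<open>U n\<close>.\<close>
    have "y \<in> U n" if "y \<in> Y" for y
    proof -
      have "\<one> \<otimes> y \<in> U n" using Y(2,4) that by blast
      then show ?thesis using openin_carrier[OF Y(1) that] by simp
    qed
    then show ?thesis using Y by (intro exI[of _ Y]) (auto simp: P_def)
  qed
  have "\<exists>V. \<forall>n. P n (V n) \<and> (\<forall>x\<in>V (Suc n). \<forall>y\<in>V (Suc n). x \<otimes> y \<in> V n)"
  proof (rule dependent_nat_choice)
    show "\<exists>X. P 0 X" using step[OF U] by meson
    show "\<exists>Y. P (Suc n) Y \<and> (\<forall>x\<in>Y. \<forall>y\<in>Y. x \<otimes> y \<in> X)" if "P n X" for X n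
      using step[of X "Suc n"] that by (simp add: P_def)
  qed
  then show ?thesis unfolding nbhd_chain_def P_def by metis
qed

lemma nbhd_chain_decseq:
  assumes V: "nbhd_chain V" and "m \<le> n"
  shows "V n \<subseteq> V m"
proof -
  have "V (Suc n) \<subseteq> V n" for n
  proof
    fix x assume x: "x \<in> V (Suc n)"
    show "x \<in> V n"
      using nbhd_chainD(4)[OF V nbhd_chainD(2)[OF V] x] nbhd_chainD(5)[OF V x] by simp
  qed
  then show ?thesis using \<open>m \<le> n\<close> by (rule lift_Suc_antimono_le)
qed

text \<open>The neighbourhood \<open>V (Suc n) #> y\<close> of a closure point \<open>y\<close>
  meets \<open>V (Suc n)\<close>, so \<open>y\<close> is a product of two elements of this symmetric
  set.\<close>

lemma nbhd_chain_closure: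
  assumes V: "nbhd_chain V"
  shows "T closure_of V (Suc n) \<subseteq> V n"
proof
  fix y assume y: "y \<in> T closure_of V (Suc n)"
  then have yG: "y \<in> carrier G" by (simp add: in_closure_of topspace_eq)
  have "openin T (V (Suc n) #> y)" using openin_translate[OF nbhd_chainD(1)[OF V] yG] .
  moreover have "y \<in> V (Suc n) #> y"
    using nbhd_chainD(2)[OF V, of "Suc n"] yG by (force simp: r_coset_def)
  ultimately obtain w where w: "w \<in> V (Suc n)" "w \<in> V (Suc n) #> y"
    using y by (auto simp: in_closure_of)
  then obtain v where v: "v \<in> V (Suc n)" "w = v \<otimes> y" by (auto simp: r_coset_def)
  have "y = inv v \<otimes> w" using v yG nbhd_chainD(5)[OF V v(1)] by (simp add: m_assoc[symmetric])
  then show "y \<in> V n" using nbhd_chainD(4)[OF V nbhd_chainD(3)[OF V v(1)] w(1)] by simp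
qed

text \<open>Membership of a product in \<open>V n\<close> is read off at stage \<open>Suc n\<close>.
  Since each stage contains the closure of the next, the intersection equals that of the closures,
  which is closed.\<close>

lemma nbhd_chain_INT:
  assumes V: "nbhd_chain V"
  shows "subgroup (\<Inter>n. V n) G" "closedin T (\<Inter>n. V n)"
proof -
  show "subgroup (\<Inter>n. V n) G"
  proof (rule subgroupI)
    show "(\<Inter>n. V n) \<subseteq> carrier G" using nbhd_chainD(5)[OF V] by auto
    show "(\<Inter>n. V n) \<noteq> {}" using nbhd_chainD(2)[OF V] by auto
    show "inv x \<in> (\<Inter>n. V n)" if "x \<in> (\<Inter>n. V n)" for x using that nbhd_chainD(3)[OF V] by simp
    show "x \<otimes> y \<in> (\<Inter>n. V n)" if "x \<in> (\<Inter>n. V n)" "y \<in> (\<Inter>n. V n)" for x y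
      using that nbhd_chainD(4)[OF V] by simp
  qed
  have "(\<Inter>n. T closure_of V n) \<subseteq> (\<Inter>n. V n)"
    using nbhd_chain_closure[OF V] by (meson INF_greatest INF_lower2 UNIV_I)
  moreover have "V n \<subseteq> T closure_of V n" for n
    using closure_of_subset[OF openin_subset[OF nbhd_chainD(1)[OF V]]] .
  then have "(\<Inter>n. V n) \<subseteq> (\<Inter>n. T closure_of V n)" by (intro INF_mono) auto
  moreover have "closedin T (\<Inter>n. T closure_of V n)" by (intro closedin_Inter) auto
  ultimately show "closedin T (\<Inter>n. V n)" by (metis subset_antisym)
qed

text \<open>\<open>W\<close> and the complements of the closures of the \<open>V n\<close> cover
  \<open>K\<close>; in a finite subcover the largest index gives a \<open>V n\<close> missing all
  those complements, hence inside \<open>W\<close>.\<close>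

lemma nbhd_chain_subset_open:
  assumes V: "nbhd_chain V" and K: "compactin T K" "V 0 \<subseteq> K"
    and W: "openin T W" "(\<Inter>n. V n) \<subseteq> W"
  shows "\<exists>n. V n \<subseteq> W"
proof -
  define O' where "O' = (\<lambda>n. topspace T - T closure_of V n)"
  have "K \<subseteq> \<Union>(insert W (range O'))"
  proof
    fix x assume x: "x \<in> K"
    then have xT: "x \<in> topspace T" using compactin_subset_topspace[OF K(1)] by blast
    show "x \<in> \<Union>(insert W (range O'))"
    proof (cases "x \<in> W")
      case False
      then obtain n where "x \<notin> V n" using W(2) by blast
      \<comment> \<open>The index moves up by one: a point outside \<open>V n\<close> may be in its
        closure, but not in the closure of \<open>V (Suc n)\<close>.\<close>
      then have "x \<in> O' (Suc n)" using nbhd_chain_closure[OF V, of n] xT by (auto simp: O'_def)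
      then show ?thesis by blast
    qed simp
  qed
  moreover have "\<forall>U\<in>insert W (range O'). openin T U" using W(1) by (auto simp: O'_def)
  ultimately obtain F where F: "finite F" "F \<subseteq> insert W (range O')" "K \<subseteq> \<Union>F"
    using K(1) unfolding compactin_def by meson
  have "finite (F - {W})" "F - {W} \<subseteq> range O'" using F by auto
  then obtain M where M: "finite M" "F - {W} = O' ` M" using finite_subset_image by metis
  \<comment> \<open>Inserting 0 keeps \<open>Max\<close> meaningful when the subcover uses none of
    the complements.\<close>
  define m where "m = Max (insert 0 M)"
  have m: "n \<le> m" if "n \<in> M" for n using that M(1) by (simp add: m_def)
  have "V m \<subseteq> W"
  proof
    fix x assume x: "x \<in> V m"
    then have "x \<in> K" using nbhd_chain_decseq[OF V, of 0 m] K(2) by auto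
    moreover have "x \<notin> O' n" if "n \<in> M" for n
    proof -
      have "x \<in> V n" using nbhd_chain_decseq[OF V m[OF that]] x by blast
      then show ?thesis
        using closure_of_subset[OF openin_subset[OF nbhd_chainD(1)[OF V, of n]]] by (auto simp: O'_def)
    qed
    ultimately show "x \<in> W" using F(3) M(2) by blast
  qed
  then show ?thesis by blast
qed

text \<open>Finitely many translates of \<open>V n\<close> cover each \<open>K m\<close>; the images
  of all these translates form a countable base, because every open set containing \<open>N\<close>
  contains some \<open>V n\<close>.\<close>

lemma nbhd_chain_second_countable_quotient:
  assumes V: "nbhd_chain V" and C: "compactin T C" "V 0 \<subseteq> C"
    and K: "\<And>n::nat. compactin T (K n)" "carrier G \<subseteq> (\<Union>n. K n)"
  shows "second_countable (quotient_group_topology G T (\<Inter>n. V n))"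
proof -
  define N where "N = (\<Inter>n. V n)"
  define q where "q = (\<lambda>x. N #> x)"
  define Q where "Q = quotient_group_topology G T N"
  have N: "subgroup N G" unfolding N_def by (rule nbhd_chain_INT(1)[OF V])
  have "\<exists>D. finite D \<and> D \<subseteq> carrier G \<and> K m \<subseteq> (\<Union>d\<in>D. V n #> d)" for m n
  proof -
    have KG: "K m \<subseteq> carrier G" using compactin_subset_topspace[OF K(1)] topspace_eq by simp
    have "K m \<subseteq> \<Union>((\<lambda>d. V n #> d) ` carrier G)"
    proof
      fix x assume "x \<in> K m"
      then have x: "x \<in> carrier G" using KG by blast
      then have "x \<in> V n #> x"
        using nbhd_chainD(2)[OF V, of n] by (force simp: r_coset_def)
      then show "x \<in> \<Union>((\<lambda>d. V n #> d) ` carrier G)" using x by blast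
    qed
    moreover have "\<forall>U\<in>(\<lambda>d. V n #> d) ` carrier G. openin T U"
      using openin_translate[OF nbhd_chainD(1)[OF V]] by simp
    ultimately obtain F where F: "finite F" "F \<subseteq> (\<lambda>d. V n #> d) ` carrier G" "K m \<subseteq> \<Union>F"
      using K(1)[of m] unfolding compactin_def by meson
    then obtain D where "D \<subseteq> carrier G" "finite D" "F = (\<lambda>d. V n #> d) ` D"
      using finite_subset_image by metis
    then show ?thesis using F(3) by (intro exI[of _ D]) simp
  qed
  then obtain D where D: "\<And>m n. finite (D m n)" "\<And>m n. D m n \<subseteq> carrier G"
    "\<And>m n. K m \<subseteq> (\<Union>d\<in>D m n. V n #> d)" by metis
  define \<B> where "\<B> = (\<Union>m. \<Union>n. (\<lambda>d. q ` (V n #> d)) ` D m n)"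
  have "countable \<B>" unfolding \<B>_def using D(1) by (intro countable_UN countableI_type countable_image countable_finite)
  moreover have "openin Q B" if B: "B \<in> \<B>" for B
  proof -
    obtain m n d where d: "d \<in> D m n" "B = q ` (V n #> d)" using B by (auto simp: \<B>_def)
    have "d \<in> carrier G" using D(2) d(1) by blast
    then show ?thesis unfolding d(2) q_def Q_def
      by (intro openin_quotient_image[OF N] openin_translate nbhd_chainD(1)[OF V])
  qed
  moreover have "\<exists>B\<in>\<B>. X \<in> B \<and> B \<subseteq> W" if W: "openin Q W" "X \<in> W" for W X
  proof -
    have "W \<subseteq> q ` topspace T" and pre: "openin T {x \<in> topspace T. q x \<in> W}"
      using W(1) unfolding Q_def q_def quotient_group_topology_def openin_quotient_topology by auto
    then obtain x where x: "x \<in> carrier G" "X = q x" using W(2) topspace_eq by blast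
    \<comment> \<open>Translating by \<open>inv x\<close> moves the preimage of \<open>W\<close>
      from the coset of \<open>x\<close> to \<open>N\<close>, where the chain can be compared with
      it.\<close>
    define W' where "W' = {x \<in> topspace T. q x \<in> W} #> inv x"
    have "openin T W'" unfolding W'_def using x by (intro openin_translate pre) simp
    moreover have "N \<subseteq> W'"
    proof
      fix n assume n: "n \<in> N"
      have nG: "n \<in> carrier G" by (rule subgroup.mem_carrier[OF N n])
      have "n \<otimes> x \<in> N #> x" using n by (auto simp: r_coset_def)
      then have "q (n \<otimes> x) = q x" using repr_independence[OF _ x(1) N] by (simp add: q_def)
      then have "n \<otimes> x \<in> {x \<in> topspace T. q x \<in> W}" using W(2) x nG by (simp add: topspace_eq)
      then have "(n \<otimes> x) \<otimes> inv x \<in> W'" by (auto simp: W'_def r_coset_def)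
      then show "n \<in> W'" using nG x by (simp add: m_assoc)
    qed
    ultimately obtain n where n: "V n \<subseteq> W'"
      using nbhd_chain_subset_open[OF V C, of W'] by (auto simp: N_def)
    obtain m where "x \<in> K m" using K(2) x(1) by blast
    \<comment> \<open>Stage \<open>Suc n\<close> is chosen because two points
      \<open>w \<otimes> d\<close> and \<open>v \<otimes> d\<close> of one translate then differ by
      \<open>w \<otimes> inv v\<close>, an element of \<open>V n\<close>.\<close>
    then obtain d where d: "d \<in> D m (Suc n)" "x \<in> V (Suc n) #> d" using D(3) by blast
    have dG: "d \<in> carrier G" using D(2) d(1) by blast
    obtain v where v: "v \<in> V (Suc n)" "x = v \<otimes> d" using d(2) by (auto simp: r_coset_def)
    note vG = nbhd_chainD(5)[OF V v(1)]
    have "q y \<in> W" if y: "y \<in> V (Suc n) #> d" for y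
    proof -
      obtain w where w: "w \<in> V (Suc n)" "y = w \<otimes> d" using y by (auto simp: r_coset_def)
      note wG = nbhd_chainD(5)[OF V w(1)]
      have "w \<otimes> inv v \<in> V n"
        by (rule nbhd_chainD(4)[OF V w(1) nbhd_chainD(3)[OF V v(1)]])
      then have "w \<otimes> inv v \<in> W'" using n by blast
      then obtain z where z: "z \<in> carrier G" "q z \<in> W" "w \<otimes> inv v = z \<otimes> inv x"
        by (auto simp: W'_def r_coset_def topspace_eq)
      \<comment> \<open>The preimage point \<open>z\<close> turns out to be \<open>y\<close>, since
        \<open>x = v \<otimes> d\<close> cancels \<open>inv v\<close>.\<close>
      have "z = (z \<otimes> inv x) \<otimes> x" using z(1) x(1) by (simp add: m_assoc)
      also have "\<dots> = (w \<otimes> inv v) \<otimes> (v \<otimes> d)" by (simp add: z(3)[symmetric] v(2)[symmetric])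
      also have "\<dots> = w \<otimes> (inv v \<otimes> (v \<otimes> d))" using wG vG dG by (simp add: m_assoc)
      also have "inv v \<otimes> (v \<otimes> d) = d" using vG dG by (simp add: m_assoc[symmetric])
      also have "w \<otimes> d = y" by (simp add: w(2))
      finally show ?thesis using z(2) by simp
    qed
    then have "q ` (V (Suc n) #> d) \<subseteq> W" by blast
    moreover have "X \<in> q ` (V (Suc n) #> d)" using d(2) x(2) by simp
    moreover have "q ` (V (Suc n) #> d) \<in> \<B>" using d(1) unfolding \<B>_def by blast
    ultimately show ?thesis by blast
  qed
  ultimately show ?thesis unfolding second_countable_def Q_def N_def by meson
qed

section \<open>Metrizable quotients of sigma-compact groups\<close>

lemma sigma_compact_ex_quotient:
  assumes comm: "comm_group G" and lc: "locally_compact_space T" and inf: "infinite (carrier G)"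
    and K: "\<And>n::nat. compactin T (K n)" "carrier G \<subseteq> (\<Union>n. K n)"
  shows "\<exists>N. N \<lhd> G \<and> closedin T N \<and> infinite (carrier (G Mod N)) \<and>
    separable_space (quotient_group_topology G T N) \<and>
    metrizable_space (quotient_group_topology G T N)"
proof -
  have "\<one> \<in> topspace T" by (simp add: topspace_eq)
  then obtain U0 C where C: "openin T U0" "compactin T C" "\<one> \<in> U0" "U0 \<subseteq> C"
    using lc unfolding locally_compact_space_def by blast
  obtain f :: "nat \<Rightarrow> 'a" where f: "inj f" "range f \<subseteq> carrier G"
    using inf infinite_countable_subset by blast
  have fG: "f i \<in> carrier G" for i using f(2) by blast
  \<comment> \<open>The finitely many quotients that stage \<open>n\<close> must avoid. Finite sets
    are closed here, and injectivity of \<open>f\<close> keeps \<open>\<one>\<close> outside, so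
    removing them from \<open>U0\<close> leaves a neighbourhood of the identity.\<close>
  define E where "E = (\<lambda>n. (\<lambda>(i, j). f i \<otimes> inv f j) ` {(i, j). i < j \<and> j \<le> n})"
  have "finite (E n)" for n
  proof -
    have "{(i, j). i < j \<and> j \<le> n} \<subseteq> {..n} \<times> {..n}" by auto
    then have "finite {(i, j). i < j \<and> j \<le> n}" by (rule finite_subset) simp
    then show ?thesis unfolding E_def by (rule finite_imageI)
  qed
  moreover have EG: "E n \<subseteq> topspace T" for n using fG by (auto simp: E_def topspace_eq)
  ultimately have "closedin T (E n)" for n
    using Hausdorff_imp_t1_space[OF Hausdorff] by (simp add: t1_space_closedin_finite)
  then have "openin T (U0 - E n)" for n using C(1) by (intro openin_diff)
  moreover have "\<one> \<in> U0 - E n" for n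
  proof -
    have "f i \<otimes> inv f j \<noteq> \<one>" if "i < j" for i j
    proof
      assume "f i \<otimes> inv f j = \<one>"
      then have "f i = f j" using inv_equality[of "f i" "inv f j"] fG by simp
      then show False using f(1) that by (auto dest: injD)
    qed
    then have "\<one> \<notin> E n" by (force simp: E_def)
    then show ?thesis using C(3) by simp
  qed
  ultimately obtain V where V: "nbhd_chain V" and VU: "\<And>n. V n \<subseteq> U0 - E n"
    using ex_nbhd_chain[of "\<lambda>n. U0 - E n"] by auto
  define N where "N = (\<Inter>n. V n)"
  have N: "subgroup N G" "closedin T N" unfolding N_def by (rule nbhd_chain_INT[OF V])+
  have normal: "N \<lhd> G" by (rule comm_group.subgroup_imp_normal[OF comm N(1)])
  define Q where "Q = quotient_group_topology G T N"
  have V0: "V 0 \<subseteq> C" using VU[of 0] C(4) by blast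
  have sc: "second_countable Q" unfolding Q_def N_def
    by (rule nbhd_chain_second_countable_quotient[OF V C(2) V0 K])
  interpret Q: topological_group "G Mod N" Q
    unfolding Q_def by (rule topological_group_quotient[OF normal N(2)])
  have qm: "quotient_map T Q (\<lambda>x. N #> x)"
    unfolding Q_def quotient_group_topology_def by (rule quotient_map_quotient_topology)
  have "locally_compact_space Q"
  proof (rule locally_compact_space_continuous_open_map_image[OF _ _ _ lc])
    show "continuous_map T Q (\<lambda>x. N #> x)" by (rule quotient_imp_continuous_map[OF qm])
    show "open_map T Q (\<lambda>x. N #> x)"
      unfolding open_map_def Q_def using openin_quotient_image[OF N(1)] by simp
    show "(\<lambda>x. N #> x) ` topspace T = topspace Q" by (rule quotient_imp_surjective_map[OF qm])
  qed
  \<comment> \<open>Regularity comes from local compactness, which the open continuous projection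
    transfers to the quotient.\<close>
  then have "regular_space Q"
    using Q.Hausdorff by (rule locally_compact_Hausdorff_imp_regular_space)
  then have "metrizable_space Q"
    using Q.Hausdorff sc by (rule regular_second_countable_imp_metrizable_space)
  moreover have "separable_space Q" using sc by (rule second_countable_imp_separable_space)
  moreover have "infinite (carrier (G Mod N))"
  proof -
    \<comment> \<open>Equal cosets would put \<open>f i \<otimes> inv f j\<close> in
      \<open>V j\<close>, which was chosen disjoint from \<open>E j\<close>.\<close>
    have ne: "N #> f i \<noteq> N #> f j" if "i < j" for i j
    proof
      assume "N #> f i = N #> f j"
      then have "f i \<otimes> inv f j \<in> N" using rcos_eq_iff[OF N(1) fG fG] by simp
      then have "f i \<otimes> inv f j \<in> V j" by (simp add: N_def)
      moreover have "f i \<otimes> inv f j \<in> E j" using that by (force simp: E_def)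
      ultimately show False using VU[of j] by blast
    qed
    have "inj (\<lambda>i. N #> f i)"
    proof (rule injI)
      fix i j assume "N #> f i = N #> f j"
      then show "i = j" using ne[of i j] ne[of j i] by (cases i j rule: linorder_cases) auto
    qed
    moreover have "range (\<lambda>i. N #> f i) \<subseteq> carrier (G Mod N)" using fG by (auto simp: carrier_FactGroup)
    ultimately show ?thesis using infinite_super range_inj_infinite by metis
  qed
  ultimately show ?thesis using normal N(2) unfolding Q_def by blast
qed

section \<open>Compact products, open subgroups and sigma-compactness\<close>

lemma compactin_set_mult:
  assumes "compactin T A" "compactin T B"
  shows "compactin T (A <#> B)"
proof -
  have "compactin (prod_topology T T) (A \<times> B)" using assms by (simp add: compactin_Times)
  from image_compactin[OF this continuous_mult]
  have "compactin T ((\<lambda>(x, y). x \<otimes> y) ` (A \<times> B))" .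
  moreover have "(\<lambda>(x, y). x \<otimes> y) ` (A \<times> B) = A <#> B" by (force simp: set_mult_def)
  ultimately show ?thesis by simp
qed

lemma openin_subgroup:
  assumes H: "subgroup H G" and U: "openin T U" "\<one> \<in> U" "U \<subseteq> H"
  shows "openin T H"
proof (subst openin_subopen, intro ballI)
  fix h assume h: "h \<in> H"
  have hG: "h \<in> carrier G" by (rule subgroup.mem_carrier[OF H h])
  have "openin T (U #> h)" by (rule openin_translate[OF U(1) hG])
  moreover have "h \<in> U #> h" using U(2) hG by (force simp: r_coset_def)
  moreover have "U #> h \<subseteq> H" using U(3) h subgroup.m_closed[OF H] by (auto simp: r_coset_def)
  ultimately show "\<exists>S. openin T S \<and> h \<in> S \<and> S \<subseteq> H" by blast
qed

text \<open>Every coset is open and projects to a single point, so the points of the quotient are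
  open. For such quotients separability becomes countability.\<close>

lemma quotient_group_topology_open_subgroup:
  assumes N: "subgroup N G" and op: "openin T N"
  shows "quotient_group_topology G T N = discrete_topology (rcosets N)"
proof -
  have top: "topspace (quotient_group_topology G T N) = rcosets N"
    by (auto simp: quotient_group_topology_def topspace_quotient_topology topspace_eq RCOSETS_def)
  have "openin (quotient_group_topology G T N) {X}" if X: "X \<in> rcosets N" for X
  proof -
    obtain a where a: "a \<in> carrier G" "X = N #> a" using X by (auto simp: RCOSETS_def)
    have "(\<lambda>x. N #> x) ` (N #> a) = {X}"
    proof -
      have "N #> x = X" if "x \<in> N #> a" for x
        using repr_independence[OF that a(1) N] a(2) by simp
      moreover have "a \<in> N #> a" by (rule rcos_self[OF a(1) N])
      ultimately show ?thesis by auto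
    qed
    then show ?thesis using openin_quotient_image[OF N openin_translate[OF op a(1)]] by simp
  qed
  then show ?thesis using top by (metis discrete_topology_unique)
qed

text \<open>The complement is the union of the other cosets, each a translate of \<open>N\<close>
  and so open.\<close>

lemma closedin_open_subgroup:
  assumes N: "subgroup N G" and op: "openin T N"
  shows "closedin T N"
proof -
  have "topspace T - N = \<Union>(rcosets N - {N})"
  proof (intro subset_antisym subsetI)
    fix x assume "x \<in> topspace T - N"
    then have x: "x \<in> carrier G" "x \<notin> N" by (simp_all add: topspace_eq)
    have "x \<in> N #> x" by (rule rcos_self[OF x(1) N])
    moreover have "N #> x \<in> rcosets N - {N}" using x \<open>x \<in> N #> x\<close> by (auto simp: RCOSETS_def)
    ultimately show "x \<in> \<Union>(rcosets N - {N})" by blast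
  next
    fix x assume "x \<in> \<Union>(rcosets N - {N})"
    then obtain a where a: "a \<in> carrier G" "x \<in> N #> a" "N #> a \<noteq> N" by (auto simp: RCOSETS_def)
    have xG: "x \<in> carrier G" by (rule subgroup.elemrcos_carrier[OF N is_group a(1,2)])
    have "N #> a = N #> x" by (rule repr_independence[OF a(2,1) N])
    then have "x \<notin> N" using a(3) subgroup.rcos_const[OF N is_group, of x] by auto
    then show "x \<in> topspace T - N" using xG by (simp add: topspace_eq)
  qed
  moreover have "openin T (\<Union>(rcosets N - {N}))"
    using openin_translate[OF op] by (intro openin_Union) (auto simp: RCOSETS_def)
  ultimately show ?thesis
    using openin_subset[OF op] by (simp add: closedin_def)
qed

text \<open>The iterated squares of the symmetrised \<open>C\<close> are compact and exhaust
  \<open>H\<close>; translating them by representatives of the countably many cosets exhausts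
  \<open>G\<close>.\<close>

lemma countable_cosets_sigma_compact:
  assumes C: "compactin T C" and H: "H = generate G C" and cnt: "countable (rcosets H)"
  shows "\<exists>K. (\<forall>n::nat. compactin T (K n)) \<and> carrier G \<subseteq> (\<Union>n. K n)"
proof -
  have CG: "C \<subseteq> carrier G" using compactin_subset_topspace[OF C] topspace_eq by simp
  define P where "P = rec_nat ({\<one>} \<union> C \<union> (\<lambda>x. inv x) ` C) (\<lambda>_ A. A <#> A)"
  have P: "P 0 = {\<one>} \<union> C \<union> (\<lambda>x. inv x) ` C" "P (Suc n) = P n <#> P n" for n
    by (simp_all add: P_def)
  have P_compact: "compactin T (P n)" for n
  proof (induction n)
    case 0
    have "compactin T {\<one>}" by (simp add: topspace_eq)
    then show ?case unfolding P using C image_compactin[OF C continuous_inv]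
      by (intro compactin_Un)
  next
    case (Suc n)
    then show ?case unfolding P by (intro compactin_set_mult)
  qed
  have PG: "P n \<subseteq> carrier G" for n using compactin_subset_topspace[OF P_compact] topspace_eq by simp
  have HP: "H \<subseteq> (\<Union>n. P n)" unfolding H
    by (rule generate_subset_UN_squares[of C P, OF CG _ P(2) PG]) (simp add: P(1))
  have "\<forall>X\<in>rcosets H. \<exists>a. a \<in> carrier G \<and> X = H #> a" by (auto simp: RCOSETS_def)
  then obtain r where "\<forall>X\<in>rcosets H. r X \<in> carrier G \<and> X = H #> r X"
    using bchoice[of "rcosets H" "\<lambda>X a. a \<in> carrier G \<and> X = H #> a"] by blast
  then have r: "r X \<in> carrier G" "H #> r X = X" if "X \<in> rcosets H" for X
    using that by auto
  \<comment> \<open>Representatives listed along an enumeration of the cosets. As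
    \<open>rcosets H\<close> is nonempty, every value of \<open>from_nat_into\<close> is a coset,
    even when there are only finitely many.\<close>
  define c where "c = (\<lambda>k. r (from_nat_into (rcosets H) k))"
  have ne: "rcosets H \<noteq> {}" using one_closed unfolding RCOSETS_def by blast
  have cG: "c k \<in> carrier G" for k unfolding c_def using r(1)[OF from_nat_into[OF ne]] by simp
  \<comment> \<open>Decoding \<open>m\<close> into a stage and a coset index turns the double family
    into a single sequence.\<close>
  define K where "K = (\<lambda>m. case prod_decode m of (n, k) \<Rightarrow> P n <#> {c k})"
  have "compactin T (K m)" for m
    using P_compact cG by (auto simp: K_def topspace_eq split: prod.split intro!: compactin_set_mult)
  moreover have "carrier G \<subseteq> (\<Union>m. K m)"
  proof
    fix x assume x: "x \<in> carrier G"
    have sub: "subgroup H G" unfolding H by (rule generate_is_subgroup[OF CG])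
    have "H #> x \<in> rcosets H" using x by (auto simp: RCOSETS_def)
    then obtain k where k: "from_nat_into (rcosets H) k = H #> x"
      using from_nat_into_surj[OF cnt] by blast
    have "x \<in> H #> c k"
      using rcos_self[OF x sub] r(2)[OF \<open>H #> x \<in> rcosets H\<close>] by (simp add: c_def k)
    then obtain h where h: "h \<in> H" "x = h \<otimes> c k" by (auto simp: r_coset_def)
    then obtain n where "h \<in> P n" using HP by blast
    then have "x \<in> K (prod_encode (n, k))" using h by (auto simp: K_def set_mult_def)
    then show "x \<in> (\<Union>m. K m)" by blast
  qed
  ultimately show ?thesis by blast
qed

end

section \<open>Quotients of locally compact abelian groups\<close>

theorem theorem2p12:
  fixes G (structure) and T
  assumes "topological_group G T"
    and "comm_group G"
    and "locally_compact_space T"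
    and "infinite (carrier G)"
  shows "\<exists>N. N \<lhd> G \<and> closedin T N \<and>
    infinite (carrier (G Mod N)) \<and>
    separable_space (quotient_group_topology G T N) \<and>
    metrizable_space (quotient_group_topology G T N)"
proof -
  interpret topological_group G T by (rule assms(1))
  interpret comm_group G by (rule assms(2))
  have "\<one> \<in> topspace T" by (simp add: topspace_eq)
  then obtain U C where C: "openin T U" "compactin T C" "\<one> \<in> U" "U \<subseteq> C"
    using assms(3) unfolding locally_compact_space_def by blast
  define H where "H = generate G C"
  have "C \<subseteq> carrier G" using compactin_subset_topspace[OF C(2)] topspace_eq by simp
  then have H: "subgroup H G" unfolding H_def by (rule generate_is_subgroup)
  have UH: "U \<subseteq> H" using C(4) generate.incl[of _ C G] by (auto simp: H_def)
  show ?thesis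
  proof (cases "countable (rcosets H)")
    case True
    then show ?thesis
      using countable_cosets_sigma_compact[OF C(2) H_def]
        sigma_compact_ex_quotient[OF assms(2-4)] by blast
  next
    case False
    then have "infinite (rcosets H)" using countable_finite by blast
    then obtain N where N: "subgroup N G" "H \<subseteq> N" "infinite (rcosets N)" "countable (rcosets N)"
      using ex_countably_infinite_quotient_above[OF H] by blast
    \<comment> \<open>Through \<open>H\<close>, the subgroup \<open>N\<close> contains the
      neighbourhood \<open>U\<close> of the identity.\<close>
    have op: "openin T N" using N(2) UH by (intro openin_subgroup[OF N(1) C(1,3)]) simp
    show ?thesis
    proof (intro exI[of _ N] conjI)
      show "N \<lhd> G" by (rule subgroup_imp_normal[OF N(1)])
      show "closedin T N" by (rule closedin_open_subgroup[OF N(1) op])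
      show "infinite (carrier (G Mod N))" using N(3) by (simp add: FactGroup_def)
    \<comment> \<open>The quotient is discrete, hence metrizable, and countable, hence
      separable.\<close>
    qed (simp_all add: quotient_group_topology_open_subgroup[OF N(1) op]
        separable_space_discrete_topology N(4))
  qed
qed

end
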